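(* Let $R$ be a prime ring and let $M$ be a faithful left $R$-module. If $M$ is $*$-prime and polyform, then $\mathrm{End}_R(M)$ is a prime ring.
   Context: Rings are associative and unital. Homomorphisms of left modules are written on the right of their arguments. For submodules $N,L$ of $M$ put $N*L = N\,\mathrm{Hom}_R(M,L)=\sum\{(N)f \mid f\in \mathrm{Hom}_R(M,L)\}$. $M$ is called $*$-prime if $N*L\neq 0$ for all non-zero submodules $N,L$ of $M$. The category $\sigma[M]$ is the full subcategory of left $R$-modules consisting of submodules of quotients of direct sums of copies of $M$; a module $N\in\sigma[M]$ is $M$-singular if $N\simeq L/K$ for some $L,K\in\sigma[M]$ with $K$ an essential submodule of $L$. $M$ is called polyform (or non-$M$-singular) if it contains no non-zero $M$-singular submodule, equivalently if $\mathrm{Hom}_R(L/K,M)=0$ for all submodules $K\subseteq L\subseteq M$ with $K$ essential in $L$. *)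

theory Defs
  imports "HOL-Algebra.Module" "HOL-Algebra.Ideal_Product" "HOL-Algebra.Generated_Groups"
begin

locale prime_ring = ring +
  assumes carrier_nontrivial: "carrier R \<noteq> {\<zero>}"
    and ideal_prod_zeroD:
      "\<lbrakk>ideal I R; ideal J R; ideal_prod R I J = {\<zero>}\<rbrakk> \<Longrightarrow> I = {\<zero>} \<or> J = {\<zero>}"

text \<open>The library locale \<open>module\<close> requires a commutative ring of scalars; this is the
  same set of axioms over an arbitrary ring. The record type, and the locale \<open>submodule\<close>,
  which does not involve commutativity, are those of the library. The ring components
  \<open>mult\<close> and \<open>one\<close> of a module record carry no meaning.\<close>

locale left_module = R?: ring R + M?: abelian_group M
  for R :: "('r, 's) ring_scheme" (structure) and M :: "('r, 'm, 't) module_scheme" (structure) +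
  assumes smult_closed:
      "\<lbrakk>a \<in> carrier R; x \<in> carrier M\<rbrakk> \<Longrightarrow> a \<odot>\<^bsub>M\<^esub> x \<in> carrier M"
    and smult_l_distr:
      "\<lbrakk>a \<in> carrier R; b \<in> carrier R; x \<in> carrier M\<rbrakk> \<Longrightarrow>
        (a \<oplus>\<^bsub>R\<^esub> b) \<odot>\<^bsub>M\<^esub> x = a \<odot>\<^bsub>M\<^esub> x \<oplus>\<^bsub>M\<^esub> b \<odot>\<^bsub>M\<^esub> x"
    and smult_r_distr:
      "\<lbrakk>a \<in> carrier R; x \<in> carrier M; y \<in> carrier M\<rbrakk> \<Longrightarrow>
        a \<odot>\<^bsub>M\<^esub> (x \<oplus>\<^bsub>M\<^esub> y) = a \<odot>\<^bsub>M\<^esub> x \<oplus>\<^bsub>M\<^esub> a \<odot>\<^bsub>M\<^esub> y"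
    and smult_assoc:
      "\<lbrakk>a \<in> carrier R; b \<in> carrier R; x \<in> carrier M\<rbrakk> \<Longrightarrow>
        (a \<otimes>\<^bsub>R\<^esub> b) \<odot>\<^bsub>M\<^esub> x = a \<odot>\<^bsub>M\<^esub> (b \<odot>\<^bsub>M\<^esub> x)"
    and smult_one:
      "x \<in> carrier M \<Longrightarrow> \<one>\<^bsub>R\<^esub> \<odot>\<^bsub>M\<^esub> x = x"

definition faithful_module :: "('r, 's) ring_scheme \<Rightarrow> ('r, 'm, 't) module_scheme \<Rightarrow> bool"
  where "faithful_module R M \<longleftrightarrow>
    (\<forall>r\<in>carrier R. (\<forall>x\<in>carrier M. r \<odot>\<^bsub>M\<^esub> x = \<zero>\<^bsub>M\<^esub>) \<longrightarrow> r = \<zero>\<^bsub>R\<^esub>)"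

text \<open>A submodule \<open>N\<close> of \<open>M\<close>, regarded as a module.\<close>

abbreviation sub_module :: "('r, 'm, 't) module_scheme \<Rightarrow> 'm set \<Rightarrow> ('r, 'm, 't) module_scheme"
  where "sub_module M N \<equiv> M\<lparr>carrier := N\<rparr>"

text \<open>Homomorphisms are extensional (\<open>undefined\<close> off the carrier), so that equality in HOL is
  equality of homomorphisms.\<close>

definition module_Hom ::
    "('r, 's) ring_scheme \<Rightarrow> ('r, 'm, 't) module_scheme \<Rightarrow> ('r, 'n, 'u) module_scheme
      \<Rightarrow> ('m \<Rightarrow> 'n) set"
  where "module_Hom R M N = {f \<in> carrier M \<rightarrow>\<^sub>E carrier N.
    (\<forall>x\<in>carrier M. \<forall>y\<in>carrier M. f (x \<oplus>\<^bsub>M\<^esub> y) = f x \<oplus>\<^bsub>N\<^esub> f y) \<and>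
    (\<forall>r\<in>carrier R. \<forall>x\<in>carrier M. f (r \<odot>\<^bsub>M\<^esub> x) = r \<odot>\<^bsub>N\<^esub> f x)}"

definition module_iso ::
    "('r, 's) ring_scheme \<Rightarrow> ('r, 'm, 't) module_scheme \<Rightarrow> ('r, 'n, 'u) module_scheme \<Rightarrow> bool"
  where "module_iso R M N \<longleftrightarrow> (\<exists>f\<in>module_Hom R M N. bij_betw f (carrier M) (carrier N))"

text \<open>Homomorphisms are written on the right of their arguments, so in a product \<open>f \<otimes> g\<close> the
  map \<open>f\<close> is applied first.\<close>

definition End_ring :: "('r, 's) ring_scheme \<Rightarrow> ('r, 'm, 't) module_scheme \<Rightarrow> ('m \<Rightarrow> 'm) ring"
  where "End_ring R M =
    \<lparr>carrier = module_Hom R M M,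
     mult = (\<lambda>f g. \<lambda>x\<in>carrier M. g (f x)),
     one = (\<lambda>x\<in>carrier M. x),
     zero = (\<lambda>x\<in>carrier M. \<zero>\<^bsub>M\<^esub>),
     add = (\<lambda>f g. \<lambda>x\<in>carrier M. f x \<oplus>\<^bsub>M\<^esub> g x)\<rparr>"

text \<open>\<open>N * L\<close>: the sum of the submodules \<open>(N)f\<close>, i.e. the additive subgroup generated by
  their union.\<close>

definition star_prod ::
    "('r, 's) ring_scheme \<Rightarrow> ('r, 'm, 't) module_scheme \<Rightarrow> 'm set \<Rightarrow> 'm set \<Rightarrow> 'm set"
  where "star_prod R M N L =
    generate (add_monoid M) (\<Union>f\<in>module_Hom R M (sub_module M L). f ` N)"

definition star_prime :: "('r, 's) ring_scheme \<Rightarrow> ('r, 'm, 't) module_scheme \<Rightarrow> bool"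
  where "star_prime R M \<longleftrightarrow>
    (\<forall>N L. submodule N R M \<and> submodule L R M \<and> N \<noteq> {\<zero>\<^bsub>M\<^esub>} \<and> L \<noteq> {\<zero>\<^bsub>M\<^esub>}
      \<longrightarrow> star_prod R M N L \<noteq> {\<zero>\<^bsub>M\<^esub>})"

definition essential_submodule ::
    "('r, 's) ring_scheme \<Rightarrow> ('r, 'm, 't) module_scheme \<Rightarrow> 'm set \<Rightarrow> bool"
  where "essential_submodule R L K \<longleftrightarrow> submodule K R L \<and>
    (\<forall>H. submodule H R L \<and> H \<noteq> {\<zero>\<^bsub>L\<^esub>} \<longrightarrow> K \<inter> H \<noteq> {\<zero>\<^bsub>L\<^esub>})"

definition direct_power :: "('r, 'm, 't) module_scheme \<Rightarrow> 'i set \<Rightarrow> ('r, 'i \<Rightarrow> 'm) module"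
  where "direct_power M I =
    \<lparr>carrier = {f \<in> I \<rightarrow>\<^sub>E carrier M. finite {i\<in>I. f i \<noteq> \<zero>\<^bsub>M\<^esub>}},
     mult = undefined,
     one = undefined,
     zero = (\<lambda>i\<in>I. \<zero>\<^bsub>M\<^esub>),
     add = (\<lambda>f g. \<lambda>i\<in>I. f i \<oplus>\<^bsub>M\<^esub> g i),
     smult = (\<lambda>r f. \<lambda>i\<in>I. r \<odot>\<^bsub>M\<^esub> f i)\<rparr>"

text \<open>On a coset \<open>X = x + U\<close> the union below is the single coset \<open>r x + U\<close>.\<close>

definition quotient_module :: "('r, 'm, 't) module_scheme \<Rightarrow> 'm set \<Rightarrow> ('r, 'm set) module"
  where "quotient_module M U =
    \<lparr>carrier = a_rcosets\<^bsub>M\<^esub> U,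
     mult = undefined,
     one = undefined,
     zero = U,
     add = set_add M,
     smult = (\<lambda>r X. \<Union>x\<in>X. U +>\<^bsub>M\<^esub> (r \<odot>\<^bsub>M\<^esub> x))\<rparr>"

text \<open>Membership in \<open>\<sigma>[M]\<close>. Index sets of the direct sums are taken in \<open>'n \<times> nat\<close>, where \<open>'n\<close> is
  the type of the elements of \<open>N\<close>. This loses nothing: if \<open>N\<close> is a submodule of a quotient of
  \<open>M^(I)\<close> for any set \<open>I\<close>, lift every element of \<open>N\<close> to a finitely supported family; the union
  \<open>J\<close> of the supports injects into \<open>'n \<times> nat\<close>, and \<open>N\<close> embeds into a quotient of
  \<open>M^(J)\<close>.\<close>

definition in_sigma ::
    "('r, 's) ring_scheme \<Rightarrow> ('r, 'm, 't) module_scheme \<Rightarrow> ('r, 'n, 'u) module_scheme \<Rightarrow> bool"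
  where "in_sigma R M N \<longleftrightarrow> left_module R N \<and>
    (\<exists>(I :: ('n \<times> nat) set) U P.
       submodule U R (direct_power M I) \<and>
       submodule P R (quotient_module (direct_power M I) U) \<and>
       module_iso R N (sub_module (quotient_module (direct_power M I) U) P))"

text \<open>\<open>N \<cong> L/K\<close> with \<open>L, K \<in> \<sigma>[M]\<close> and \<open>K\<close> essential in \<open>L\<close>. Up to isomorphism the elements of
  \<open>L\<close> may be taken in the type of cosets in \<open>M^(J)\<close>, \<open>J\<close> a subset of \<open>'n \<times> nat\<close>: replace \<open>L\<close> by
  the submodule \<open>L'\<close> generated by one preimage of each element of \<open>N\<close>. Then \<open>L' \<inter> K\<close> is
  essential in \<open>L'\<close>, \<open>L'/(L' \<inter> K) \<cong> N\<close>, and \<open>L'\<close> embeds into a quotient of \<open>M^(J)\<close> as above.\<close>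

definition M_singular ::
    "('r, 's) ring_scheme \<Rightarrow> ('r, 'm, 't) module_scheme \<Rightarrow> ('r, 'n, 'u) module_scheme \<Rightarrow> bool"
  where "M_singular R M N \<longleftrightarrow> in_sigma R M N \<and>
    (\<exists>(L :: ('r, ('n \<times> nat \<Rightarrow> 'm) set) module) K.
       in_sigma R M L \<and> essential_submodule R L K \<and> in_sigma R M (sub_module L K) \<and>
       module_iso R N (quotient_module L K))"

definition polyform :: "('r, 's) ring_scheme \<Rightarrow> ('r, 'm, 't) module_scheme \<Rightarrow> bool"
  where "polyform R M \<longleftrightarrow>
    (\<forall>N. submodule N R M \<and> M_singular R M (sub_module M N) \<longrightarrow> N = {\<zero>\<^bsub>M\<^esub>})"

end

theory Submission
  imports Defs
begin

text \<open>Let \<open>f\<close>, \<open>g\<close> be non-zero endomorphisms. The kernel of \<open>g\<close> is not essential in \<open>M\<close>, since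
  otherwise the image of \<open>g\<close> would be a non-zero \<open>M\<close>-singular submodule of \<open>M\<close>. So some non-zero
  submodule \<open>L\<close> meets the kernel of \<open>g\<close> trivially. As \<open>(M)f * L \<noteq> 0\<close>, there is an endomorphism \<open>h\<close>
  with image in \<open>L\<close> and \<open>f h \<noteq> 0\<close>; then \<open>f h g \<noteq> 0\<close>.\<close>

section \<open>Submodules of a module over an arbitrary ring\<close>

context left_module
begin

lemma smult_r_null: "a \<in> carrier R \<Longrightarrow> a \<odot>\<^bsub>M\<^esub> \<zero>\<^bsub>M\<^esub> = \<zero>\<^bsub>M\<^esub>"
  by (metis M.add.l_cancel_one' M.zero_closed M.l_zero smult_closed smult_r_distr)

lemma smult_l_null: "x \<in> carrier M \<Longrightarrow> \<zero>\<^bsub>R\<^esub> \<odot>\<^bsub>M\<^esub> x = \<zero>\<^bsub>M\<^esub>"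
  by (metis M.add.l_cancel_one' R.zero_closed R.l_zero smult_closed smult_l_distr)

lemma smult_minus_one:
  assumes "x \<in> carrier M"
  shows "(\<ominus>\<^bsub>R\<^esub> \<one>\<^bsub>R\<^esub>) \<odot>\<^bsub>M\<^esub> x = \<ominus>\<^bsub>M\<^esub> x"
proof -
  have "(\<ominus>\<^bsub>R\<^esub> \<one>\<^bsub>R\<^esub>) \<odot>\<^bsub>M\<^esub> x \<oplus>\<^bsub>M\<^esub> x = (\<ominus>\<^bsub>R\<^esub> \<one>\<^bsub>R\<^esub> \<oplus>\<^bsub>R\<^esub> \<one>\<^bsub>R\<^esub>) \<odot>\<^bsub>M\<^esub> x"
    using assms by (simp add: smult_l_distr smult_one)
  also have "\<dots> = \<zero>\<^bsub>M\<^esub>"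
    using assms by (simp add: R.l_neg smult_l_null)
  finally show ?thesis
    using assms by (simp add: M.minus_equality smult_closed)
qed

text \<open>The locale \<open>submodule\<close> also asks for closure under negation. This follows
  from the other conditions because the ring is unital: -x = (-1)x.\<close>

lemma submodule_iff:
  "submodule H R M \<longleftrightarrow> H \<subseteq> carrier M \<and> \<zero>\<^bsub>M\<^esub> \<in> H \<and> (\<forall>x\<in>H. \<forall>y\<in>H. x \<oplus>\<^bsub>M\<^esub> y \<in> H)
    \<and> (\<forall>r\<in>carrier R. \<forall>x\<in>H. r \<odot>\<^bsub>M\<^esub> x \<in> H)" (is "_ \<longleftrightarrow> ?rhs")
proof
  assume "submodule H R M"
  then interpret submodule H R M .
  show ?rhs
    using subset one_closed m_closed by auto
next
  assume H: ?rhs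
  have "\<ominus>\<^bsub>M\<^esub> x \<in> H" if "x \<in> H" for x
    using H that smult_minus_one[of x] R.a_inv_closed[OF R.one_closed] by (metis subsetD)
  then show "submodule H R M"
    using H by (auto intro!: submodule.intro subgroup.intro submodule_axioms.intro simp: a_inv_def)
qed

lemma left_module_sub_module:
  assumes "submodule N R M"
  shows "left_module R (sub_module M N)"
proof -
  note N = assms[unfolded submodule_iff]
  have "abelian_group (sub_module M N)"
  proof (rule abelian_groupI)
    fix x assume x: "x \<in> carrier (sub_module M N)"
    have "\<ominus>\<^bsub>M\<^esub> x \<in> N"
      using N x smult_minus_one[of x, symmetric] R.a_inv_closed[OF R.one_closed] by auto
    then show "\<exists>y\<in>carrier (sub_module M N). y \<oplus>\<^bsub>sub_module M N\<^esub> x = \<zero>\<^bsub>sub_module M N\<^esub>"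
      using N x by (auto intro!: bexI[of _ "\<ominus>\<^bsub>M\<^esub> x"] simp: M.l_neg subset_iff)
  qed (use N in \<open>auto simp: subset_iff M.a_ac\<close>)
  then show ?thesis
    using N by (intro left_module.intro R.ring_axioms left_module_axioms.intro)
      (auto simp: subset_iff smult_l_distr smult_r_distr smult_assoc smult_one)
qed

end

section \<open>Homomorphisms, kernels and images\<close>

lemma module_Hom_closed: "f \<in> module_Hom R M N \<Longrightarrow> x \<in> carrier M \<Longrightarrow> f x \<in> carrier N"
  by (auto simp: module_Hom_def)

lemma module_Hom_add:
  "f \<in> module_Hom R M N \<Longrightarrow> x \<in> carrier M \<Longrightarrow> y \<in> carrier M \<Longrightarrow> f (x \<oplus>\<^bsub>M\<^esub> y) = f x \<oplus>\<^bsub>N\<^esub> f y"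
  by (auto simp: module_Hom_def)

lemma module_Hom_smult:
  "f \<in> module_Hom R M N \<Longrightarrow> r \<in> carrier R \<Longrightarrow> x \<in> carrier M \<Longrightarrow> f (r \<odot>\<^bsub>M\<^esub> x) = r \<odot>\<^bsub>N\<^esub> f x"
  by (auto simp: module_Hom_def)

lemma module_Hom_zero:
  assumes "left_module R M" "left_module R N" and f: "f \<in> module_Hom R M N"
  shows "f \<zero>\<^bsub>M\<^esub> = \<zero>\<^bsub>N\<^esub>"
proof -
  interpret M: left_module R M by fact
  interpret N: left_module R N by fact
  have "f \<zero>\<^bsub>M\<^esub> \<oplus>\<^bsub>N\<^esub> f \<zero>\<^bsub>M\<^esub> = f \<zero>\<^bsub>M\<^esub>"
    using module_Hom_add[OF f M.M.zero_closed M.M.zero_closed] by simp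
  then show ?thesis
    using module_Hom_closed[OF f M.M.zero_closed] by (simp add: N.M.add.l_cancel_one)
qed

lemma module_Hom_comp:
  assumes "f \<in> module_Hom R M N" "g \<in> module_Hom R N P" "left_module R M"
  shows "(\<lambda>x\<in>carrier M. g (f x)) \<in> module_Hom R M P"
proof -
  interpret M: left_module R M by fact
  show ?thesis
    using assms(1,2) by (auto simp: module_Hom_def M.smult_closed Pi_iff PiE_iff)
qed

lemma kernel_submodule:
  assumes "left_module R M" "left_module R N" "f \<in> module_Hom R M N"
  shows "submodule {x \<in> carrier M. f x = \<zero>\<^bsub>N\<^esub>} R M"
proof -
  interpret M: left_module R M by fact
  interpret N: left_module R N by fact
  show ?thesis
    using assms(3) unfolding M.submodule_iff
    by (auto simp: M.smult_closed module_Hom_zero[OF assms] module_Hom_add module_Hom_smult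
        N.smult_r_null)
qed

lemma image_submodule:
  assumes "left_module R M" "left_module R N" "f \<in> module_Hom R M N" "submodule H R M"
  shows "submodule (f ` H) R N"
proof -
  interpret M: left_module R M by fact
  interpret N: left_module R N by fact
  note H = assms(4)[unfolded M.submodule_iff]
  show ?thesis
    unfolding N.submodule_iff
  proof (intro conjI ballI)
    show "f ` H \<subseteq> carrier N"
      using H assms(3) by (auto intro: module_Hom_closed)
    show "\<zero>\<^bsub>N\<^esub> \<in> f ` H"
      using H module_Hom_zero[OF assms(1-3)] by (metis imageI)
  next
    fix x y assume "x \<in> f ` H" "y \<in> f ` H"
    then show "x \<oplus>\<^bsub>N\<^esub> y \<in> f ` H"
      using H by (auto simp: subset_iff module_Hom_add[OF assms(3), symmetric])
  next
    fix r x assume "r \<in> carrier R" "x \<in> f ` H"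
    then show "r \<odot>\<^bsub>N\<^esub> x \<in> f ` H"
      using H by (auto simp: subset_iff module_Hom_smult[OF assms(3), symmetric])
  qed
qed

section \<open>Isomorphisms, transport of structure and the first isomorphism theorem\<close>

lemma module_iso_sym:
  assumes "left_module R M" "module_iso R M N"
  shows "module_iso R N M"
proof -
  interpret M: left_module R M by fact
  obtain f where f: "f \<in> module_Hom R M N" and bij: "bij_betw f (carrier M) (carrier N)"
    using assms(2) by (auto simp: module_iso_def)
  \<comment> \<open>The inverse map is cut down to the carrier because \<open>module_Hom\<close>
    admits extensional functions only.\<close>
  define g where "g = restrict (inv_into (carrier M) f) (carrier N)"
  have gf: "g (f x) = x" if "x \<in> carrier M" for x
    using that bij module_Hom_closed[OF f that] by (simp add: g_def bij_betw_def)
  have surj: "\<exists>x\<in>carrier M. y = f x" if "y \<in> carrier N" for y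
    using that bij by (auto simp: bij_betw_def)
  have "g \<in> module_Hom R N M"
    unfolding module_Hom_def
  proof (intro CollectI conjI ballI)
    show "g \<in> carrier N \<rightarrow>\<^sub>E carrier M"
      using gf surj by (force simp: g_def)
  next
    fix x y assume "x \<in> carrier N" "y \<in> carrier N"
    then obtain a b where "a \<in> carrier M" "b \<in> carrier M" "x = f a" "y = f b"
      using surj by blast
    then show "g (x \<oplus>\<^bsub>N\<^esub> y) = g x \<oplus>\<^bsub>M\<^esub> g y"
      by (simp add: module_Hom_add[OF f, symmetric] gf)
  next
    fix r x assume "r \<in> carrier R" "x \<in> carrier N"
    moreover from this obtain a where "a \<in> carrier M" "x = f a"
      using surj by blast
    ultimately show "g (r \<odot>\<^bsub>N\<^esub> x) = r \<odot>\<^bsub>M\<^esub> g x"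
      by (simp add: module_Hom_smult[OF f, symmetric] gf M.smult_closed)
  qed
  moreover have "bij_betw g (carrier N) (carrier M)"
    using bij by (simp add: g_def bij_betw_inv_into)
  ultimately show ?thesis
    by (auto simp: module_iso_def)
qed

text \<open>The module axioms pass along any surjection that respects the operations.
  \<open>Q\<close> is a bare record here, so its zero is an arbitrary field and f(0) = 0 has to be a
  hypothesis. This makes modules out of direct powers and quotients without computing with families
  or cosets.\<close>

lemma left_module_transport:
  assumes "left_module R M" and f: "f \<in> module_Hom R M Q"
    and surj: "f ` carrier M = carrier Q" and zero: "f \<zero>\<^bsub>M\<^esub> = \<zero>\<^bsub>Q\<^esub>"
  shows "left_module R Q"
proof -
  interpret M: left_module R M by fact
  note [simp] = module_Hom_add[OF f, symmetric] module_Hom_smult[OF f, symmetric]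
    zero[symmetric] surj[symmetric] M.smult_closed
  have "abelian_group Q"
  proof (rule abelian_groupI)
    fix x assume "x \<in> carrier Q"
    then obtain a where "a \<in> carrier M" "x = f a"
      by auto
    then show "\<exists>y\<in>carrier Q. y \<oplus>\<^bsub>Q\<^esub> x = \<zero>\<^bsub>Q\<^esub>"
      by (auto simp: M.M.l_neg intro!: bexI[of _ "\<ominus>\<^bsub>M\<^esub> a"])
  qed (auto simp: M.M.a_ac)
  then show ?thesis
    by (intro left_module.intro M.R.ring_axioms left_module_axioms.intro)
      (auto simp: M.smult_l_distr M.smult_r_distr M.smult_assoc M.smult_one)
qed

text \<open>The cosets of the kernel are exactly the fibres of \<open>g\<close>, so sending n to the
  fibre over n is an isomorphism from \<open>N\<close> onto the quotient. The quotient inherits the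
  module axioms from \<open>N\<close> along this map.\<close>

lemma quotient_by_kernel:
  assumes "left_module R L" "left_module R N" and g: "g \<in> module_Hom R L N"
    and surj: "g ` carrier L = carrier N"
  defines "K \<equiv> {x \<in> carrier L. g x = \<zero>\<^bsub>N\<^esub>}"
  shows "left_module R (quotient_module L K)" "module_iso R N (quotient_module L K)"
proof -
  interpret L: left_module R L by fact
  interpret N: left_module R N by fact
  note g_simps = module_Hom_add[OF g] module_Hom_smult[OF g] module_Hom_closed[OF g]
    module_Hom_zero[OF assms(1-3)] L.smult_closed
  define F where "F = (\<lambda>n\<in>carrier N. {x \<in> carrier L. g x = n})"
  have coset: "K +>\<^bsub>L\<^esub> x = F (g x)" if x: "x \<in> carrier L" for x
  proof -
    \<comment> \<open>The fibre lies in the coset: y = (y - x) + x, and y - x is in the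
      kernel.\<close>
    have "y \<in> K +>\<^bsub>L\<^esub> x" if y: "y \<in> carrier L" "g y = g x" for y
    proof -
      have "g ((y \<ominus>\<^bsub>L\<^esub> x) \<oplus>\<^bsub>L\<^esub> x) = g (y \<ominus>\<^bsub>L\<^esub> x) \<oplus>\<^bsub>N\<^esub> g x"
        using x y by (intro module_Hom_add[OF g]) auto
      moreover have "(y \<ominus>\<^bsub>L\<^esub> x) \<oplus>\<^bsub>L\<^esub> x = y"
        using x y by (simp add: L.M.minus_eq L.M.a_assoc L.M.l_neg)
      ultimately have "g (y \<ominus>\<^bsub>L\<^esub> x) = \<zero>\<^bsub>N\<^esub>"
        using x y g_simps(3) by (metis L.M.minus_closed N.M.add.r_cancel_one')
      then show ?thesis
        using x y \<open>(y \<ominus>\<^bsub>L\<^esub> x) \<oplus>\<^bsub>L\<^esub> x = y\<close> unfolding a_r_coset_def' K_def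
        by (auto intro!: bexI[of _ "y \<ominus>\<^bsub>L\<^esub> x"])
    qed
    then show ?thesis
      using x by (auto simp: F_def a_r_coset_def' K_def g_simps)
  qed
  have carr: "carrier (quotient_module L K) = F ` carrier N"
    unfolding quotient_module_def A_RCOSETS_def' by (auto simp: surj[symmetric] coset)
  have F: "F \<in> module_Hom R N (quotient_module L K)"
    unfolding module_Hom_def
  proof (intro CollectI conjI ballI)
    show "F \<in> carrier N \<rightarrow>\<^sub>E carrier (quotient_module L K)"
      unfolding carr by (auto simp: F_def)
  next
    fix x y assume xy: "x \<in> carrier N" "y \<in> carrier N"
    obtain a b where ab: "a \<in> carrier L" "b \<in> carrier L" "x = g a" "y = g b"
      using xy surj by blast
    \<comment> \<open>The fibre over x + y lies in the sum of the two fibres: split u as (u - b) +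
      b, where b lies over y and hence u - b lies over x.\<close>
    have "u \<in> set_add L (F x) (F y)" if u: "u \<in> carrier L" "g u = x \<oplus>\<^bsub>N\<^esub> y" for u
    proof -
      have eq: "(u \<ominus>\<^bsub>L\<^esub> b) \<oplus>\<^bsub>L\<^esub> b = u"
        using u ab by (simp add: L.M.minus_eq L.M.a_assoc L.M.l_neg)
      have "g (u \<ominus>\<^bsub>L\<^esub> b) \<oplus>\<^bsub>N\<^esub> y = x \<oplus>\<^bsub>N\<^esub> y"
        using module_Hom_add[OF g, of "u \<ominus>\<^bsub>L\<^esub> b" b] eq u ab by simp
      then have "g (u \<ominus>\<^bsub>L\<^esub> b) = x"
        using xy u ab g_simps(3) by (metis L.M.minus_closed N.M.add.right_cancel)
      then have "u \<ominus>\<^bsub>L\<^esub> b \<in> F x" "b \<in> F y"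
        using u ab xy by (simp_all add: F_def)
      then show ?thesis
        unfolding set_add_def' using eq by blast
    qed
    then show "F (x \<oplus>\<^bsub>N\<^esub> y) = F x \<oplus>\<^bsub>quotient_module L K\<^esub> F y"
      using xy by (auto simp: quotient_module_def F_def set_add_def' g_simps)
  next
    fix r x assume rx: "r \<in> carrier R" "x \<in> carrier N"
    obtain a where a: "a \<in> carrier L" "x = g a"
      using rx surj by blast
    \<comment> \<open>All members of the union that defines the scalar action are this one coset.
      The element a shows that the union is not over the empty set.\<close>
    have "K +>\<^bsub>L\<^esub> (r \<odot>\<^bsub>L\<^esub> u) = F (r \<odot>\<^bsub>N\<^esub> x)" if "u \<in> F x" for u
      using that rx coset[of "r \<odot>\<^bsub>L\<^esub> u"] by (auto simp: F_def g_simps)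
    moreover have "a \<in> F x"
      using a rx by (simp add: F_def)
    ultimately show "F (r \<odot>\<^bsub>N\<^esub> x) = r \<odot>\<^bsub>quotient_module L K\<^esub> F x"
      unfolding quotient_module_def by auto
  qed
  have "inj_on F (carrier N)"
  proof (rule inj_onI)
    fix x y assume xy: "x \<in> carrier N" "y \<in> carrier N" "F x = F y"
    obtain a where "a \<in> carrier L" "x = g a"
      using xy surj by blast
    then have "a \<in> F y"
      using xy by (auto simp: F_def)
    then show "x = y"
      using xy \<open>x = g a\<close> by (simp add: F_def)
  qed
  with F carr show "module_iso R N (quotient_module L K)"
    by (auto simp: module_iso_def bij_betw_def)
  show "left_module R (quotient_module L K)"
    using left_module_transport[OF assms(2) F] carr by (simp add: F_def quotient_module_def K_def)
qed

text \<open>An isomorphic copy of \<open>M\<close> in the type of cosets to which the definition of \<open>M_singular\<close>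
  confines the module \<open>L\<close>.\<close>

lemma singleton_power_quotient:
  fixes M :: "('r, 'm, 't) module_scheme" and i :: 'i
  assumes "left_module R M"
  defines "D \<equiv> direct_power M {i}"
  shows "submodule {\<zero>\<^bsub>D\<^esub>} R D" "left_module R (quotient_module D {\<zero>\<^bsub>D\<^esub>})"
    "module_iso R M (quotient_module D {\<zero>\<^bsub>D\<^esub>})"
proof -
  interpret M: left_module R M by fact
  \<comment> \<open>\<open>c\<close> sends x to the family with single entry x, and \<open>p\<close>
    below evaluates a family at i. Over one index every family has finite support, so
    \<open>c\<close> is onto \<open>D\<close> and transports the module axioms to it.\<close>
  define c where "c = (\<lambda>x\<in>carrier M. \<lambda>j\<in>{i}. x)"
  have D: "carrier D = {i} \<rightarrow>\<^sub>E carrier M"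
    by (auto simp: D_def direct_power_def)
  have c_hom: "c \<in> module_Hom R M D"
    by (auto simp: module_Hom_def D c_def M.smult_closed) (auto simp: D_def direct_power_def fun_eq_iff)
  have c_surj: "c ` carrier M = carrier D"
  proof
    show "c ` carrier M \<subseteq> carrier D"
      using c_hom by (auto intro: module_Hom_closed)
    show "carrier D \<subseteq> c ` carrier M"
    proof
      fix u assume u: "u \<in> carrier D"
      then have "u = c (u i)"
        unfolding D c_def by (auto simp: fun_eq_iff PiE_iff extensional_def)
      then show "u \<in> c ` carrier M"
        using u by (auto simp: D PiE_iff)
    qed
  qed
  have "left_module R D"
    using left_module_transport[OF assms(1) c_hom c_surj] by (simp add: c_def D_def direct_power_def)
  then interpret D: left_module R D .
  define p where "p = (\<lambda>u\<in>carrier D. u i)"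
  have pc: "p (c x) = x" if "x \<in> carrier M" for x
    using that module_Hom_closed[OF c_hom that] by (simp add: p_def c_def)
  have p_hom: "p \<in> module_Hom R D M"
    by (auto simp: module_Hom_def p_def D.smult_closed) (auto simp: D PiE_iff D_def direct_power_def)
  have p_surj: "p ` carrier D = carrier M"
    using pc by (simp add: c_surj[symmetric] image_image)
  \<comment> \<open>Since \<open>p\<close> has trivial kernel, the first isomorphism theorem for
    \<open>p\<close> identifies \<open>M\<close> with the quotient of \<open>D\<close> by its zero
    submodule.\<close>
  have ker: "{u \<in> carrier D. p u = \<zero>\<^bsub>M\<^esub>} = {\<zero>\<^bsub>D\<^esub>}"
    using module_Hom_zero[OF assms(1) \<open>left_module R D\<close> c_hom] pc[OF M.M.zero_closed]
    by (auto simp: c_surj[symmetric] pc intro: image_eqI[of _ _ "\<zero>\<^bsub>M\<^esub>"])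
  show "submodule {\<zero>\<^bsub>D\<^esub>} R D"
    using kernel_submodule[OF \<open>left_module R D\<close> assms(1) p_hom] ker by simp
  show "left_module R (quotient_module D {\<zero>\<^bsub>D\<^esub>})" "module_iso R M (quotient_module D {\<zero>\<^bsub>D\<^esub>})"
    using quotient_by_kernel[OF \<open>left_module R D\<close> assms(1) p_hom p_surj] ker by simp_all
qed

section \<open>Membership in \<sigma>[M] for modules that embed in M\<close>

text \<open>One copy of \<open>M\<close> is enough: composing the embedding with the isomorphism
  from \<open>M\<close> to a quotient of a one-fold power realises \<open>N\<close> as a submodule
  of that quotient.\<close>

lemma in_sigma_if_embeds:
  fixes N :: "('r, 'n, 'u) module_scheme" and M :: "('r, 'm, 't) module_scheme"
  assumes "left_module R M" "left_module R N" and f: "f \<in> module_Hom R N M"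
    and inj: "inj_on f (carrier N)"
  shows "in_sigma R M N"
proof -
  interpret N: left_module R N by fact
  \<comment> \<open>Here \<open>undefined\<close> is just some element of the index type that
    \<open>in_sigma\<close> prescribes; any other would do.\<close>
  define D where "D = direct_power M {undefined :: 'n \<times> nat}"
  define Q where "Q = quotient_module D {\<zero>\<^bsub>D\<^esub>}"
  note Q = singleton_power_quotient[OF assms(1), of "undefined :: 'n \<times> nat", folded D_def, folded Q_def]
  obtain e where e: "e \<in> module_Hom R M Q" "bij_betw e (carrier M) (carrier Q)"
    using Q(3) by (auto simp: module_iso_def)
  define h where "h = (\<lambda>x\<in>carrier N. e (f x))"
  have h: "h \<in> module_Hom R N Q"
    unfolding h_def by (rule module_Hom_comp[OF f e(1) assms(2)])
  have "submodule (carrier N) R N"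
    by (auto simp: N.submodule_iff N.smult_closed)
  then have P: "submodule (h ` carrier N) R Q"
    by (rule image_submodule[OF assms(2) Q(2) h])
  have "inj_on h (carrier N)"
    using e(2) inj module_Hom_closed[OF f] by (auto simp: h_def inj_on_def bij_betw_def)
  moreover have "h \<in> module_Hom R N (sub_module Q (h ` carrier N))"
    using h by (auto simp: module_Hom_def PiE_iff)
  ultimately have "module_iso R N (sub_module Q (h ` carrier N))"
    by (auto simp: module_iso_def bij_betw_def)
  with Q(1) P show ?thesis
    unfolding in_sigma_def Q_def D_def using assms(2) by blast
qed

text \<open>Restricting the embedding of \<open>L\<close> embeds the submodule. This serves both
  submodules of \<open>M\<close> and submodules of the isomorphic copy of \<open>M\<close> used
  below.\<close>

lemma sub_module_in_sigma:
  assumes "left_module R M" "left_module R L" "f \<in> module_Hom R L M" "inj_on f (carrier L)"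
    and "submodule N R L"
  shows "in_sigma R M (sub_module L N)"
proof (rule in_sigma_if_embeds)
  have N: "N \<subseteq> carrier L"
    using assms(5) by (simp add: left_module.submodule_iff[OF assms(2)])
  show "left_module R (sub_module L N)"
    using assms(2,5) by (rule left_module.left_module_sub_module)
  show "restrict f N \<in> module_Hom R (sub_module L N) M"
    using assms(3,5) N unfolding left_module.submodule_iff[OF assms(2)]
    by (auto simp: module_Hom_def PiE_iff subset_iff)
  show "inj_on (restrict f N) (carrier (sub_module L N))"
    using assms(4) N by (auto simp: inj_on_def)
qed fact

section \<open>Kernels of endomorphisms of polyform modules\<close>

text \<open>The image of \<open>g\<close> is isomorphic to M modulo the kernel of \<open>g\<close>,
  hence \<open>M\<close>-singular if that kernel is essential. \<open>M_singular\<close> wants the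
  module in the numerator to have cosets as elements, so the argument is carried out in the copy
  \<open>Q\<close> of \<open>M\<close>.\<close>

lemma polyform_kernel_not_essential:
  fixes M :: "('r, 'm, 't) module_scheme"
  assumes "left_module R M" "polyform R M" and g: "g \<in> module_Hom R M M"
    and ess: "essential_submodule R M {x \<in> carrier M. g x = \<zero>\<^bsub>M\<^esub>}"
    and x: "x \<in> carrier M"
  shows "g x = \<zero>\<^bsub>M\<^esub>"
proof -
  interpret M: left_module R M by fact
  define D where "D = direct_power M {undefined :: 'm \<times> nat}"
  define Q where "Q = quotient_module D {\<zero>\<^bsub>D\<^esub>}"
  note Q = singleton_power_quotient[OF assms(1), of "undefined :: 'm \<times> nat", folded D_def, folded Q_def]
  interpret Q: left_module R Q by (fact Q(2))
  obtain p where p: "p \<in> module_Hom R Q M" "bij_betw p (carrier Q) (carrier M)"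
    using module_iso_sym[OF assms(1) Q(3)] by (auto simp: module_iso_def)
  have p_inj: "inj_on p (carrier Q)" and p_surj: "p ` carrier Q = carrier M"
    using p(2) by (auto simp: bij_betw_def)
  define N where "N = g ` carrier M"
  have "submodule (carrier M) R M"
    by (auto simp: M.submodule_iff M.smult_closed)
  then have N: "submodule N R M"
    unfolding N_def by (rule image_submodule[OF assms(1) assms(1) g])
  have N_mod: "left_module R (sub_module M N)"
    by (rule M.left_module_sub_module[OF N])
  \<comment> \<open>\<open>q\<close> is \<open>g\<close> read on \<open>Q\<close>, with its codomain
    cut down to the image; its kernel \<open>K\<close> corresponds to the kernel of \<open>g\<close>
    under the isomorphism \<open>p\<close>.\<close>
  define q where "q = (\<lambda>u\<in>carrier Q. g (p u))"
  have "q \<in> module_Hom R Q M"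
    unfolding q_def by (rule module_Hom_comp[OF p(1) g Q(2)])
  then have q: "q \<in> module_Hom R Q (sub_module M N)"
    using module_Hom_closed[OF p(1)] by (auto simp: module_Hom_def PiE_iff q_def N_def)
  have q_surj: "q ` carrier Q = carrier (sub_module M N)"
    by (auto simp: q_def N_def p_surj[symmetric])
  define K where "K = {u \<in> carrier Q. q u = \<zero>\<^bsub>sub_module M N\<^esub>}"
  have K: "submodule K R Q"
    unfolding K_def by (rule kernel_submodule[OF Q(2) N_mod q])
  \<comment> \<open>Essentiality is carried from \<open>M\<close> back to \<open>Q\<close>:
    \<open>p\<close> is injective, so it maps a non-zero \<open>H\<close> to a non-zero submodule of
    \<open>M\<close>, which meets the kernel of \<open>g\<close> non-trivially.\<close>
  have "K \<inter> H \<noteq> {\<zero>\<^bsub>Q\<^esub>}" if H: "submodule H R Q" "H \<noteq> {\<zero>\<^bsub>Q\<^esub>}" for H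
  proof -
    have H': "H \<subseteq> carrier Q" "\<zero>\<^bsub>Q\<^esub> \<in> H"
      using H(1) by (auto simp: Q.submodule_iff)
    have p0: "p \<zero>\<^bsub>Q\<^esub> = \<zero>\<^bsub>M\<^esub>"
      by (rule module_Hom_zero[OF Q(2) assms(1) p(1)])
    have "p ` H \<noteq> {\<zero>\<^bsub>M\<^esub>}"
    proof
      assume "p ` H = {\<zero>\<^bsub>M\<^esub>}"
      then have "p u = p \<zero>\<^bsub>Q\<^esub>" if "u \<in> H" for u
        using that p0 by auto
      then have "u = \<zero>\<^bsub>Q\<^esub>" if "u \<in> H" for u
        using that H' inj_onD[OF p_inj] by (meson subsetD)
      with H(2) H'(2) show False by blast
    qed
    moreover have pH: "submodule (p ` H) R M"
      by (rule image_submodule[OF Q(2) assms(1) p(1) H(1)])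
    ultimately have "{x \<in> carrier M. g x = \<zero>\<^bsub>M\<^esub>} \<inter> p ` H \<noteq> {\<zero>\<^bsub>M\<^esub>}"
      using ess by (auto simp: essential_submodule_def)
    \<comment> \<open>As the intersection contains zero, differing from the zero submodule means
      having a non-zero element.\<close>
    moreover have "\<zero>\<^bsub>M\<^esub> \<in> {x \<in> carrier M. g x = \<zero>\<^bsub>M\<^esub>} \<inter> p ` H"
      using pH module_Hom_zero[OF assms(1) assms(1) g] by (auto simp: M.submodule_iff)
    ultimately obtain u where "u \<in> H" "g (p u) = \<zero>\<^bsub>M\<^esub>" "p u \<noteq> \<zero>\<^bsub>M\<^esub>"
      by blast
    then have "u \<in> K \<inter> H" "u \<noteq> \<zero>\<^bsub>Q\<^esub>"
      using H' p0 by (auto simp: K_def q_def)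
    then show ?thesis by blast
  qed
  with K have "essential_submodule R Q K"
    by (simp add: essential_submodule_def)
  moreover have "module_iso R (sub_module M N) (quotient_module Q K)"
    unfolding K_def by (rule quotient_by_kernel(2)[OF Q(2) N_mod q q_surj])
  moreover have "in_sigma R M (sub_module M N)"
  proof (rule sub_module_in_sigma[OF assms(1) assms(1) _ _ N])
    show "restrict id (carrier M) \<in> module_Hom R M M"
      by (auto simp: module_Hom_def M.smult_closed)
  qed simp
  moreover have "in_sigma R M Q"
    by (rule in_sigma_if_embeds[OF assms(1) Q(2) p(1) p_inj])
  moreover have "in_sigma R M (sub_module Q K)"
    by (rule sub_module_in_sigma[OF assms(1) Q(2) p(1) p_inj K])
  ultimately have "M_singular R M (sub_module M N)"
    unfolding M_singular_def by blast
  with N assms(2) have "N = {\<zero>\<^bsub>M\<^esub>}"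
    by (simp add: polyform_def)
  with x show ?thesis
    by (auto simp: N_def)
qed

section \<open>Homomorphisms supplied by *-primeness\<close>

text \<open>If every homomorphism from \<open>M\<close> to \<open>L\<close> killed \<open>N\<close>,
  all generators of N * L would be zero, and so would the subgroup that they generate.\<close>

lemma star_prime_Hom:
  assumes "left_module R M" "star_prime R M"
    and "submodule N R M" "submodule L R M" "N \<noteq> {\<zero>\<^bsub>M\<^esub>}" "L \<noteq> {\<zero>\<^bsub>M\<^esub>}"
  obtains h x where "h \<in> module_Hom R M (sub_module M L)" "x \<in> N" "h x \<noteq> \<zero>\<^bsub>M\<^esub>"
proof (rule ccontr)
  interpret M: left_module R M by fact
  assume "\<not> thesis"
  then have *: "(\<Union>f\<in>module_Hom R M (sub_module M L). f ` N) \<subseteq> {\<zero>\<^bsub>M\<^esub>}"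
    using that by auto
  have "y = \<zero>\<^bsub>M\<^esub>" if "y \<in> star_prod R M N L" for y
    using that unfolding star_prod_def
  proof (induction rule: generate.induct)
    case (incl h)
    with * show ?case by blast
  next
    case (inv h)
    with * have "h = \<zero>\<^bsub>M\<^esub>" by blast
    then show ?case
      using M.M.add.inv_one by simp
  qed simp_all
  \<comment> \<open>A generated subgroup always contains the identity, so the inclusion in the zero
    subgroup is an equality.\<close>
  moreover have "\<zero>\<^bsub>M\<^esub> \<in> star_prod R M N L"
    unfolding star_prod_def using generate.one[of "add_monoid M"] by simp
  ultimately have "star_prod R M N L = {\<zero>\<^bsub>M\<^esub>}" by blast
  with assms show False
    by (auto simp: star_prime_def)
qed

section \<open>The endomorphism ring\<close>

lemma module_Hom_ext:
  "f \<in> module_Hom R M N \<Longrightarrow> g \<in> module_Hom R M N \<Longrightarrow> (\<And>x. x \<in> carrier M \<Longrightarrow> f x = g x) \<Longrightarrow> f = g"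
  by (rule PiE_ext[of f "carrier M" "\<lambda>_. carrier N"]) (auto simp: module_Hom_def)

lemma ring_End_ring:
  assumes "left_module R M"
  shows "ring (End_ring R M)"
proof -
  interpret M: left_module R M by fact
  have add: "(\<lambda>x\<in>carrier M. f x \<oplus>\<^bsub>M\<^esub> g x) \<in> module_Hom R M M"
    if "f \<in> module_Hom R M M" "g \<in> module_Hom R M M" for f g
    using that by (auto simp: module_Hom_def PiE_iff Pi_iff M.smult_closed M.smult_r_distr
        M.M.a_ac)
  have zero: "(\<lambda>x\<in>carrier M. \<zero>\<^bsub>M\<^esub>) \<in> module_Hom R M M"
    by (auto simp: module_Hom_def M.smult_closed M.smult_r_null)
  have neg: "(\<lambda>x\<in>carrier M. \<ominus>\<^bsub>M\<^esub> f x) \<in> module_Hom R M M" if "f \<in> module_Hom R M M" for f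
  proof -
    have "r \<odot>\<^bsub>M\<^esub> (\<ominus>\<^bsub>M\<^esub> x) = \<ominus>\<^bsub>M\<^esub> (r \<odot>\<^bsub>M\<^esub> x)" if "r \<in> carrier R" "x \<in> carrier M" for r x
    proof -
      have "r \<odot>\<^bsub>M\<^esub> (\<ominus>\<^bsub>M\<^esub> x) \<oplus>\<^bsub>M\<^esub> r \<odot>\<^bsub>M\<^esub> x = \<zero>\<^bsub>M\<^esub>"
        using that by (simp add: M.smult_r_distr[symmetric] M.M.l_neg M.smult_r_null)
      then show ?thesis
        using that by (simp add: M.M.minus_equality M.smult_closed)
    qed
    with that show ?thesis
      by (auto simp: module_Hom_def PiE_iff Pi_iff M.smult_closed M.M.minus_add)
  qed
  have zero_add: "(\<lambda>x\<in>carrier M. (\<lambda>x\<in>carrier M. \<zero>\<^bsub>M\<^esub>) x \<oplus>\<^bsub>M\<^esub> f x) = f"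
    if "f \<in> module_Hom R M M" for f
    using that by (intro module_Hom_ext[OF add[OF zero that] that]) (simp add: module_Hom_closed)
  note comp = module_Hom_comp[OF _ _ assms]
  have "abelian_group (End_ring R M)"
  proof (rule abelian_groupI)
    fix f assume "f \<in> carrier (End_ring R M)"
    then show "\<exists>g\<in>carrier (End_ring R M). g \<oplus>\<^bsub>End_ring R M\<^esub> f = \<zero>\<^bsub>End_ring R M\<^esub>"
      using neg[of f] module_Hom_closed[of f R M M] unfolding End_ring_def
      by (auto intro!: bexI[of _ "\<lambda>x\<in>carrier M. \<ominus>\<^bsub>M\<^esub> f x"] restrict_ext simp: M.M.l_neg)
  next
    fix f assume "f \<in> carrier (End_ring R M)"
    then show "\<zero>\<^bsub>End_ring R M\<^esub> \<oplus>\<^bsub>End_ring R M\<^esub> f = f"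
      using zero_add by (simp add: End_ring_def del: restrict_apply)
  qed (auto simp: End_ring_def add zero module_Hom_closed[of _ R M M] M.M.a_ac intro!: restrict_ext)
  moreover have "monoid (End_ring R M)"
  proof (rule monoidI)
    fix f assume f: "f \<in> carrier (End_ring R M)"
    \<comment> \<open>Composing with the identity yields the restriction of f to the carrier, which
      is f itself by extensionality.\<close>
    then have "restrict f (carrier M) = f"
      by (auto simp: End_ring_def module_Hom_def PiE_iff extensional_restrict)
    then show "\<one>\<^bsub>End_ring R M\<^esub> \<otimes>\<^bsub>End_ring R M\<^esub> f = f" "f \<otimes>\<^bsub>End_ring R M\<^esub> \<one>\<^bsub>End_ring R M\<^esub> = f"
      using f by (auto simp: End_ring_def module_Hom_closed[of _ R M M] cong: restrict_cong)
  next
    show "\<one>\<^bsub>End_ring R M\<^esub> \<in> carrier (End_ring R M)"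
      by (auto simp: End_ring_def module_Hom_def M.smult_closed)
  qed (auto simp: End_ring_def comp module_Hom_closed[of _ R M M] intro!: restrict_ext)
  ultimately show ?thesis
    by (rule ringI) (auto simp: End_ring_def module_Hom_closed[of _ R M M] module_Hom_add[of _ R M M]
      intro!: restrict_ext)
qed

section \<open>Primeness of the endomorphism ring\<close>

text \<open>This is primeness in terms of elements: f S g is non-zero for non-zero f and g in the
  endomorphism ring S. Products act from left to right, so \<open>h\<close> has to carry a value of
  \<open>f\<close> out of the kernel of \<open>g\<close>.\<close>

lemma End_ring_mult_nonzero:
  assumes "left_module R M" "star_prime R M" "polyform R M"
    and f: "f \<in> module_Hom R M M" "f \<noteq> \<zero>\<^bsub>End_ring R M\<^esub>"
    and g: "g \<in> module_Hom R M M" "g \<noteq> \<zero>\<^bsub>End_ring R M\<^esub>"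
  obtains h where "h \<in> module_Hom R M M"
    "f \<otimes>\<^bsub>End_ring R M\<^esub> h \<otimes>\<^bsub>End_ring R M\<^esub> g \<noteq> \<zero>\<^bsub>End_ring R M\<^esub>"
proof -
  interpret M: left_module R M by fact
  have zero: "(\<lambda>x\<in>carrier M. \<zero>\<^bsub>M\<^esub>) \<in> module_Hom R M M"
    by (auto simp: module_Hom_def M.smult_closed M.smult_r_null)
  have nonzero: "\<exists>x\<in>carrier M. k x \<noteq> \<zero>\<^bsub>M\<^esub>"
    if "k \<in> module_Hom R M M" "k \<noteq> \<zero>\<^bsub>End_ring R M\<^esub>" for k
    using module_Hom_ext[OF that(1) zero] that(2) by (auto simp: End_ring_def)
  define K where "K = {x \<in> carrier M. g x = \<zero>\<^bsub>M\<^esub>}"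
  have K: "submodule K R M"
    unfolding K_def by (rule kernel_submodule[OF assms(1) assms(1) g(1)])
  have "\<not> essential_submodule R M K"
    using polyform_kernel_not_essential[OF assms(1,3) g(1)] nonzero[OF g] by (auto simp: K_def)
  \<comment> \<open>Since \<open>K\<close> is a submodule, it can only fail to be essential by
    meeting some non-zero \<open>L\<close> trivially.\<close>
  with K obtain L where L: "submodule L R M" "L \<noteq> {\<zero>\<^bsub>M\<^esub>}" "K \<inter> L = {\<zero>\<^bsub>M\<^esub>}"
    by (auto simp: essential_submodule_def)
  have "submodule (carrier M) R M"
    by (auto simp: M.submodule_iff M.smult_closed)
  then have "submodule (f ` carrier M) R M"
    by (rule image_submodule[OF assms(1) assms(1) f(1)])
  moreover have "f ` carrier M \<noteq> {\<zero>\<^bsub>M\<^esub>}"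
    using nonzero[OF f] by auto
  ultimately obtain h y where h: "h \<in> module_Hom R M (sub_module M L)" "y \<in> f ` carrier M"
      "h y \<noteq> \<zero>\<^bsub>M\<^esub>"
    using star_prime_Hom[OF assms(1,2) _ L(1) _ L(2)] by metis
  \<comment> \<open>The operations of \<open>sub_module M L\<close> are those of \<open>M\<close>,
    so \<open>h\<close> is also an endomorphism of \<open>M\<close>.\<close>
  have h': "h \<in> module_Hom R M M"
    using h(1) L(1) by (auto simp: module_Hom_def PiE_iff M.submodule_iff)
  obtain x where x: "x \<in> carrier M" "y = f x"
    using h(2) by auto
  have "h y \<in> L"
    using module_Hom_closed[OF h(1), of y] x module_Hom_closed[OF f(1)] by simp
  \<comment> \<open>The non-zero element h y lies in \<open>L\<close>, hence outside the kernel of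
    \<open>g\<close>.\<close>
  with h(3) L have "g (h (f x)) \<noteq> \<zero>\<^bsub>M\<^esub>"
    using x by (auto simp: K_def M.submodule_iff)
  then have "(f \<otimes>\<^bsub>End_ring R M\<^esub> h \<otimes>\<^bsub>End_ring R M\<^esub> g) x \<noteq> \<zero>\<^bsub>End_ring R M\<^esub> x"
    using x by (simp add: End_ring_def)
  with h' that show thesis by metis
qed

theorem mainTheorem7:
  fixes R :: "('r, 's) ring_scheme" and M :: "('r, 'm, 't) module_scheme"
  assumes "prime_ring R"
    and "left_module R M"
    and "faithful_module R M"
    and "star_prime R M"
    and "polyform R M"
  shows "prime_ring (End_ring R M)"
proof -
  interpret R: prime_ring R by fact
  interpret M: left_module R M by fact
  interpret E: ring "End_ring R M" by (rule ring_End_ring[OF assms(2)])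
  have carr: "carrier (End_ring R M) = module_Hom R M M"
    by (simp add: End_ring_def)
  show ?thesis
  proof
    \<comment> \<open>Non-triviality: in the non-zero ring \<open>R\<close> the unit differs from
      zero, so by faithfulness it does not annihilate \<open>M\<close>. Thus \<open>M\<close> is
      non-zero and its identity map is not the zero map.\<close>
    have "\<one>\<^bsub>R\<^esub> \<noteq> \<zero>\<^bsub>R\<^esub>"
      using R.carrier_nontrivial R.one_zeroD by blast
    then obtain x where x: "x \<in> carrier M" "x \<noteq> \<zero>\<^bsub>M\<^esub>"
      using assms(3) M.smult_one R.one_closed unfolding faithful_module_def by metis
    then have "\<one>\<^bsub>End_ring R M\<^esub> x \<noteq> \<zero>\<^bsub>End_ring R M\<^esub> x"
      by (simp add: End_ring_def)
    then show "carrier (End_ring R M) \<noteq> {\<zero>\<^bsub>End_ring R M\<^esub>}"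
      using E.one_closed by (metis singletonD)
  next
    fix I J
    assume I: "ideal I (End_ring R M)" and J: "ideal J (End_ring R M)"
      and IJ: "ideal_prod (End_ring R M) I J = {\<zero>\<^bsub>End_ring R M\<^esub>}"
    interpret I: ideal I "End_ring R M" by fact
    interpret J: ideal J "End_ring R M" by fact
    show "I = {\<zero>\<^bsub>End_ring R M\<^esub>} \<or> J = {\<zero>\<^bsub>End_ring R M\<^esub>}"
    proof (rule ccontr)
      assume "\<not> ?thesis"
      then obtain f g where f: "f \<in> I" "f \<noteq> \<zero>\<^bsub>End_ring R M\<^esub>"
        and g: "g \<in> J" "g \<noteq> \<zero>\<^bsub>End_ring R M\<^esub>"
        using I.zero_closed J.zero_closed by blast
      obtain h where h: "h \<in> module_Hom R M M"
        "f \<otimes>\<^bsub>End_ring R M\<^esub> h \<otimes>\<^bsub>End_ring R M\<^esub> g \<noteq> \<zero>\<^bsub>End_ring R M\<^esub>"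
        using End_ring_mult_nonzero[OF assms(2,4,5)] f g I.a_subset J.a_subset carr
        by (metis subsetD)
      \<comment> \<open>\<open>I\<close> absorbs \<open>h\<close> on the right, so the triple
        product is a single product of an element of \<open>I\<close> and an element of
        \<open>J\<close>, and therefore one of the generators of the ideal product.\<close>
      have "f \<otimes>\<^bsub>End_ring R M\<^esub> h \<in> I"
        using f h by (simp add: I.I_r_closed carr)
      then have "f \<otimes>\<^bsub>End_ring R M\<^esub> h \<otimes>\<^bsub>End_ring R M\<^esub> g \<in> ideal_prod (End_ring R M) I J"
        using g by (intro ideal_prod.prod)
      with IJ h show False by simp
    qed
  qed
qed

end
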